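(* Let $n$ and $r$ be positive integers with $r \le \lfloor n/2 \rfloor$, write $n = 2r + l$, and let $p = \min\{r, \lceil l/2 \rceil\}$. For disjoint cross intersecting families $\mathcal{A}$ and $\mathcal{B}$ of $\binom{[n]}{r}$, $$|\mathcal{A}| + |\mathcal{B}| \le \binom{n}{r} - \binom{l}{p},$$ where, in the case $l = 0$, the term $\binom{l}{p}$ is read as $0$ (so that for $n = 2r$ the asserted bound is $|\mathcal{A}| + |\mathcal{B}| \le \binom{2r}{r}$).
   Context: For a natural number $n$, $[n] = \{1, 2, \dots, n\}$, and $\binom{[n]}{r} = \{A \subseteq [n] : |A| = r\}$ is the family of all $r$-element subsets of $[n]$. Subfamilies $\mathcal{A}, \mathcal{B} \subseteq \binom{[n]}{r}$ are called cross intersecting if $A \cap B \neq \emptyset$ for all $A \in \mathcal{A}$ and all $B \in \mathcal{B}$. Cross intersecting families $\mathcal{A}$ and $\mathcal{B}$ are called disjoint if $\mathcal{A} \cap \mathcal{B} = \emptyset$, i.e. no set belongs to both families.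
   Formalization: For l > 0 both families are assumed nonempty; without this the claim fails, e.g. n = 3, r = 1, with one family empty and the other consisting of all r-subsets, where the sum is 3 but the bound is 2. *)

theory Defs
  imports Complex_Main "HOL-Library.Ramsey"
begin

definition cross_intersecting :: "'a set set \<Rightarrow> 'a set set \<Rightarrow> bool"
  where "cross_intersecting \<A> \<B> \<longleftrightarrow> (\<forall>A\<in>\<A>. \<forall>B\<in>\<B>. A \<inter> B \<noteq> {})"

(* The empty family cross-intersects every family, so for l > 0 the pair consisting of
   the empty family and all r-subsets would exceed the bound of the theorem.  The theorem
   therefore requires both families to be nonempty, but only when l > 0. *)

end

theory Submission
  imports Defs
begin

text \<open>
  Choose \<open>A \<in> \<A>\<close> and \<open>B \<in> \<B>\<close> with \<open>d = card (A - B)\<close> minimal. Two kinds of sets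
  are missing from \<open>\<A> \<union> \<B>\<close>: every \<open>r\<close>-set disjoint from \<open>A \<union> B\<close>, by the cross
  intersecting property, and every \<open>r\<close>-set strictly between \<open>A \<inter> B\<close> and \<open>A \<union> B\<close> other
  than \<open>A\<close> and \<open>B\<close>, by minimality of \<open>d\<close>. There are \<open>(r + l - d) choose r\<close> sets of the
  first kind, which suffices if \<open>d \<le> p\<close>, and at least \<open>((2 * d) choose d) - 2\<close> of the
  second kind, which suffices if \<open>d > p\<close>, since then \<open>l \<le> 2 * p\<close>.
\<close>

text \<open>By symmetry of the binomial coefficient either summand can serve as the lower index, so
  each can be raised in turn while the other stays fixed below.\<close>

lemma binomial_add_mono:
  fixes a b a' b' :: nat
  assumes "a \<le> a'" "b \<le> b'"
  shows "(a + b) choose a \<le> (a' + b') choose a'"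
proof -
  have "(a + b) choose a = (a + b) choose b"
    by (metis add_diff_cancel_left' binomial_symmetric le_add1)
  also have "\<dots> \<le> (a' + b) choose b"
    using assms(1) by (intro binomial_right_mono) auto
  also have "\<dots> = (a' + b) choose a'"
    by (metis add_diff_cancel_left' binomial_symmetric le_add1)
  also have "\<dots> \<le> (a' + b') choose a'"
    using assms(2) by (intro binomial_right_mono) auto
  finally show ?thesis .
qed

text \<open>Two Pascal steps and symmetry leave a surplus of twice
  \<open>(2 * p) choose (p - 1)\<close>, which is positive. The surplus of 2 later pays for removing
  \<open>A\<close> and \<open>B\<close>.\<close>

lemma central_binomial_Suc_ge:
  assumes "p \<ge> 1"
  shows "2 * ((2 * p) choose p) + 2 \<le> (2 * Suc p) choose Suc p"
proof -
  have "(2 * Suc p) choose Suc p = (Suc (2 * p) choose p) + (Suc (2 * p) choose Suc p)"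
    by simp
  also have "Suc (2 * p) choose Suc p = Suc (2 * p) choose p"
    using binomial_symmetric[of p "Suc (2 * p)"] by (simp add: Suc_diff_le)
  also have "Suc (2 * p) choose p = ((2 * p) choose p) + ((2 * p) choose (p - 1))"
    using assms by (cases p) auto
  finally show ?thesis
    using zero_less_binomial[of "p - 1" "2 * p"] by linarith
qed

text \<open>Equal sizes give the symmetric difference \<open>2 * card (A - B)\<close> elements;
  adjoining to \<open>A \<inter> B\<close> any half of it yields distinct
  \<open>r\<close>-sets.\<close>

lemma card_nsets_between:
  assumes "finite A" "finite B" "card A = r" "card B = r"
  shows "(2 * card (A - B)) choose card (A - B)
    \<le> card {X. A \<inter> B \<subseteq> X \<and> X \<subseteq> A \<union> B \<and> card X = r}"
    (is "_ \<le> card ?S")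
proof -
  let ?D = "(A - B) \<union> (B - A)" and ?d = "card (A - B)"
  have r: "card (A \<inter> B) + ?d = r"
    using assms card_Int_Diff[of A B] by simp
  have "card (B - A) = ?d"
    using assms r card_Int_Diff[of B A] by (simp add: Int_commute)
  then have "card ?D = 2 * ?d"
    using assms by (subst card_Un_disjoint) auto
  then have "(2 * ?d) choose ?d = card ([?D]\<^bsup>?d\<^esup>)"
    by simp
  also have "\<dots> = card ((\<lambda>Y. (A \<inter> B) \<union> Y) ` [?D]\<^bsup>?d\<^esup>)"
    by (intro card_image[symmetric] inj_onI) (auto simp: nsets_def)
  also have "\<dots> \<le> card ?S"
  proof (rule card_mono)
    show "finite ?S"
      using assms by (auto intro: finite_subset[of _ "Pow (A \<union> B)"])
    have "card ((A \<inter> B) \<union> Y) = r" if "Y \<in> [?D]\<^bsup>?d\<^esup>" for Y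
      using that r assms by (subst card_Un_disjoint) (auto simp: nsets_def)
    then show "(\<lambda>Y. (A \<inter> B) \<union> Y) ` [?D]\<^bsup>?d\<^esup> \<subseteq> ?S"
      by (auto simp: nsets_def)
  qed
  finally show ?thesis .
qed

text \<open>\<open>X - B\<close> lies in \<open>A - B\<close>, and equality would put
  \<open>A\<close> inside \<open>X\<close>, hence make them equal by size. Replacing
  \<open>A\<close> by \<open>X\<close> thus contradicts minimality of a pair.\<close>

lemma card_Diff_less_between:
  assumes "finite A" "finite X" "card X = card A" "A \<inter> B \<subseteq> X" "X \<subseteq> A \<union> B" "X \<noteq> A"
  shows "card (X - B) < card (A - B)"
proof (rule psubset_card_mono)
  show "X - B \<subset> A - B"
  proof
    show "X - B \<subseteq> A - B" using assms by auto
    show "X - B \<noteq> A - B"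
    proof
      assume "X - B = A - B"
      then have "A \<subseteq> X" using assms(4) by auto
      then show False using card_subset_eq[of X A] assms by auto
    qed
  qed
qed (use assms in auto)

text \<open>The inequalities on \<open>p\<close> replace its definition by a minimum and a ceiling,
  so that no rounding enters the counting.\<close>

lemma card_missing_nsets_ge:
  fixes r l p :: nat and V :: "'a set"
  assumes V: "finite V" "card V = 2 * r + l"
    and p: "1 \<le> p" "p \<le> l" "p \<le> r" "l \<le> 2 * p \<or> p = r"
    and A: "\<A> \<subseteq> [V]\<^bsup>r\<^esup>" "\<A> \<noteq> {}" and B: "\<B> \<subseteq> [V]\<^bsup>r\<^esup>" "\<B> \<noteq> {}"
    and cross: "cross_intersecting \<A> \<B>" and disj: "\<A> \<inter> \<B> = {}"
  shows "l choose p \<le> card ([V]\<^bsup>r\<^esup> - (\<A> \<union> \<B>))"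
proof -
  let ?M = "[V]\<^bsup>r\<^esup> - (\<A> \<union> \<B>)"
  have finM: "finite ?M" using V(1) by (simp add: finite_imp_finite_nsets)
  obtain A B where AB: "A \<in> \<A>" "B \<in> \<B>"
    and min: "\<And>A' B'. A' \<in> \<A> \<Longrightarrow> B' \<in> \<B> \<Longrightarrow> card (A - B) \<le> card (A' - B')"
  proof -
    obtain z where "z \<in> \<A> \<times> \<B>"
      and "\<forall>y. y \<in> \<A> \<times> \<B> \<longrightarrow> card (fst z - snd z) \<le> card (fst y - snd y)"
      using ex_has_least_nat[of "\<lambda>z. z \<in> \<A> \<times> \<B>" _ "\<lambda>z. card (fst z - snd z)"] A(2) B(2)
      by (metis SigmaI ex_in_conv)
    then show ?thesis by (intro that[of "fst z" "snd z"]) auto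
  qed
  have fin: "finite A" "finite B" and c: "card A = r" "card B = r" and sub: "A \<subseteq> V" "B \<subseteq> V"
    using AB A(1) B(1) by (auto simp: nsets_def)
  define d where "d = card (A - B)"
  have dr: "d \<le> r"
    using c fin card_mono[of A "A - B"] by (auto simp: d_def)
  have cBA: "card (B - A) = d"
    using fin c card_Int_Diff[of A B] card_Int_Diff[of B A] by (simp add: d_def Int_commute)
  show ?thesis
  proof (cases "d \<le> p")
    case True
    have "card (A \<union> B) = r + d"
      using fin c cBA card_Un_disjoint[of A "B - A"] by simp
    then have cN: "card (V - (A \<union> B)) = r + (l - d)"
      using V sub fin True p by (subst card_Diff_subset) auto
    \<comment> \<open>With both upper indices written as sums, \<open>p \<le> r\<close> and
      \<open>l - p \<le> l - d\<close> suffice; truncated subtraction is harmless since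
      \<open>d \<le> p \<le> l\<close>.\<close>
    have "l choose p = (p + (l - p)) choose p" using p by simp
    also have "\<dots> \<le> (r + (l - d)) choose r"
      using True p by (intro binomial_add_mono) auto
    also have "\<dots> = card ([V - (A \<union> B)]\<^bsup>r\<^esup>)"
      using cN by simp
    also have "\<dots> \<le> card ?M"
    proof (rule card_mono[OF finM], safe)
      fix X assume X: "X \<in> [V - (A \<union> B)]\<^bsup>r\<^esup>"
      then show "X \<in> [V]\<^bsup>r\<^esup>" by (auto simp: nsets_def)
      have "X \<inter> A = {}" "X \<inter> B = {}" using X by (auto simp: nsets_def)
      then show "X \<in> \<A> \<Longrightarrow> False" "X \<in> \<B> \<Longrightarrow> False"
        using cross AB unfolding cross_intersecting_def by blast+
    qed
    finally show ?thesis .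
  next
    case False
    \<comment> \<open>Here \<open>p < d \<le> r\<close> excludes the alternative
      \<open>p = r\<close>.\<close>
    with p dr have l: "l \<le> 2 * p" by auto
    let ?S = "{X. A \<inter> B \<subseteq> X \<and> X \<subseteq> A \<union> B \<and> card X = r}"
    have "l choose p \<le> (2 * p) choose p"
      using l by (rule binomial_right_mono)
    moreover have "2 * ((2 * p) choose p) + 2 \<le> (2 * d) choose d"
      using central_binomial_Suc_ge[OF p(1)] binomial_add_mono[of "Suc p" d "Suc p" d] False
      by (simp add: mult_2)
    moreover have "(2 * d) choose d \<le> card ?S"
      unfolding d_def using card_nsets_between[OF fin c] .
    moreover have "card ?S - 2 \<le> card (?S - {A, B})"
      using diff_card_le_card_Diff[of "{A, B}" ?S] card_insert_le_m1[of 2 "{B}" A] by simp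
    moreover have "card (?S - {A, B}) \<le> card ?M"
    proof (rule card_mono[OF finM], rule subsetI)
      fix X assume "X \<in> ?S - {A, B}"
      then have X: "A \<inter> B \<subseteq> X" "X \<subseteq> A \<union> B" "card X = r" "X \<noteq> A" "X \<noteq> B" by auto
      have finX: "finite X" using X(2) fin finite_subset by blast
      have "X \<in> [V]\<^bsup>r\<^esup>" using X sub finX by (auto simp: nsets_def)
      moreover have "X \<notin> \<A>"
        using card_Diff_less_between[of A X B] min[of X B] X c fin finX AB by auto
      \<comment> \<open>The roles of \<open>A\<close> and \<open>B\<close> can be exchanged because
        differences of sets of equal size have the same size in both directions.\<close>
      moreover have "X \<notin> \<B>"
      proof
        assume "X \<in> \<B>"
        then have "card (A - B) \<le> card (A - X)" using min AB by blast
        moreover have "card (X - A) < card (B - A)"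
          using card_Diff_less_between[of B X A] X c fin finX by auto
        moreover have "card (X - A) = card (A - X)"
          using fin finX c X(3) card_Int_Diff[of A X] card_Int_Diff[of X A]
          by (simp add: Int_commute)
        ultimately show False using cBA by (simp add: d_def)
      qed
      ultimately show "X \<in> ?M" by blast
    qed
    ultimately show ?thesis by linarith
  qed
qed

theorem theorem3:
  fixes n r l p :: nat and \<A> \<B> :: "nat set set"
  assumes "n > 0" and "r > 0"
    and "int r \<le> \<lfloor>real n / 2\<rfloor>"
    and "n = 2 * r + l"
    and "p = min r (nat \<lceil>real l / 2\<rceil>)"
    and "\<A> \<subseteq> [{1..n}]\<^bsup>r\<^esup>" and "\<B> \<subseteq> [{1..n}]\<^bsup>r\<^esup>"
    and "cross_intersecting \<A> \<B>"
    and "\<A> \<inter> \<B> = {}"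
    and "l > 0 \<Longrightarrow> \<A> \<noteq> {} \<and> \<B> \<noteq> {}"
  shows "int (card \<A>) + int (card \<B>)
    \<le> int (n choose r) - (if l = 0 then 0 else int (l choose p))"
proof -
  let ?N = "[{1..n}]\<^bsup>r\<^esup>"
  have finN: "finite ?N" by (simp add: finite_imp_finite_nsets)
  have fin: "finite \<A>" "finite \<B>" using assms(6,7) finN finite_subset by blast+
  have cU: "card (\<A> \<union> \<B>) = card \<A> + card \<B>"
    using fin assms(9) by (rule card_Un_disjoint)
  have cN: "card ?N = n choose r" by simp
  have le: "card (\<A> \<union> \<B>) \<le> card ?N"
    using assms(6,7) finN by (intro card_mono) auto
  have missing: "card (?N - (\<A> \<union> \<B>)) = card ?N - card (\<A> \<union> \<B>)"
    using assms(6,7) fin by (intro card_Diff_subset) auto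
  show ?thesis
  proof (cases "l = 0")
    case True
    then show ?thesis using le cU cN by simp
  next
    case False
    \<comment> \<open>For \<open>l > 0\<close> the rounded-up half of \<open>l\<close> lies between
      1 and \<open>l\<close>, and its double is at least \<open>l\<close>; if the minimum is not
      this half, it is \<open>r\<close>.\<close>
    have "1 \<le> p" "p \<le> l" "p \<le> r" "l \<le> 2 * p \<or> p = r"
      using False assms(2) unfolding assms(5) by linarith+
    then have "l choose p \<le> card (?N - (\<A> \<union> \<B>))"
      using False assms by (intro card_missing_nsets_ge) auto
    then show ?thesis using False le cU cN missing by simp
  qed
qed

end
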